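(* Let $K\ge1$ be an integer and let $p$ be an odd prime. If $q$ is a prime with $q\mid \pi_K(p)$, then $q\le p$, and equality $q=p$ can hold only if $p\mid K^2+4$.
   Context: The $K$-Fibonacci sequence is $F_{K,0}=0$, $F_{K,1}=1$, $F_{K,n}=K F_{K,n-1}+F_{K,n-2}$; for an integer $m>1$, $\pi_K(m)$ is the length of its shortest period modulo $m$. *)

theory Defs
  imports "HOL-Number_Theory.Number_Theory"
begin

fun kfib :: "nat \<Rightarrow> nat \<Rightarrow> nat" where
  "kfib K 0 = 0"
| "kfib K (Suc 0) = 1"
| "kfib K (Suc (Suc n)) = K * kfib K (Suc n) + kfib K n"

definition is_kfib_period :: "nat \<Rightarrow> nat \<Rightarrow> nat \<Rightarrow> bool" where
  "is_kfib_period K m t \<longleftrightarrow> 0 < t \<and> (\<forall>n. [kfib K (n + t) = kfib K n] (mod m))"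

definition kpisano :: "nat \<Rightarrow> nat \<Rightarrow> nat" where
  "kpisano K m = (LEAST t. is_kfib_period K m t)"

text \<open>The recurrence is invertible modulo \<open>m\<close>, so a period always exists and the
  \<open>LEAST\<close> in the definition of \<^const>\<open>kpisano\<close> is attained.\<close>

lemma is_kfib_period_exists:
  assumes "m > 0"
  shows "\<exists>t. is_kfib_period K m t"
proof -
  define f where "f i = (kfib K i mod m, kfib K (Suc i) mod m)" for i
  have "range f \<subseteq> {..<m} \<times> {..<m}"
    using assms by (auto simp: f_def)
  then have "finite (range f)"
    by (rule finite_subset) simp
  then have "\<not> inj f"
    using finite_imageD infinite_UNIV_nat by blast
  then obtain a b where "f a = f b" "a \<noteq> b"
    unfolding inj_def by blast
  then obtain i j where "f i = f j" "i < j"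
    by (metis linorder_neqE_nat)
  define t where "t = j - i"
  have t: "t > 0" "j = i + t"
    using \<open>i < j\<close> by (auto simp: t_def)
  have down: "f s = f (s + t) \<Longrightarrow> f 0 = f t" for s
  proof (induction s)
    case (Suc s)
    have a: "[kfib K (Suc s) = kfib K (Suc (s + t))] (mod m)"
      and b: "[kfib K (Suc (Suc s)) = kfib K (Suc (Suc (s + t)))] (mod m)"
      using Suc.prems unfolding f_def cong_def by simp_all
    have "[K * kfib K (Suc s) + kfib K (s + t) = K * kfib K (Suc (s + t)) + kfib K (s + t)] (mod m)"
      using a by (intro cong_add cong_mult cong_refl)
    then have "[K * kfib K (Suc s) + kfib K s = K * kfib K (Suc s) + kfib K (s + t)] (mod m)"
      using b by (metis cong_sym cong_trans kfib.simps(3))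
    then have "[kfib K s = kfib K (s + t)] (mod m)"
      by (simp add: cong_add_lcancel_nat)
    then have "f s = f (s + t)"
      using a by (simp add: f_def cong_def)
    then show ?case by (rule Suc.IH)
  qed simp
  have "f 0 = f t"
    using down[of i] \<open>f i = f j\<close> t by simp
  have "f (n + t) = f n" for n
  proof (induction n)
    case 0
    show ?case using \<open>f 0 = f t\<close> by simp
  next
    case (Suc n)
    then have "[kfib K (n + t) = kfib K n] (mod m)"
      and "[kfib K (Suc (n + t)) = kfib K (Suc n)] (mod m)"
      by (simp_all add: f_def cong_def)
    then have "[kfib K (Suc (Suc (n + t))) = kfib K (Suc (Suc n))] (mod m)"
      unfolding kfib.simps(3) by (intro cong_add cong_mult cong_refl)
    then show ?case
      using Suc by (simp add: f_def cong_def)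
  qed
  then show ?thesis
    using t unfolding is_kfib_period_def f_def cong_def by blast
qed

end

theory Submission
  imports Defs
begin

text \<open>Let \<open>\<phi> = (K + \<surd>D)/2\<close> with \<open>D = K\<^sup>2 + 4\<close>, so that \<open>\<phi>\<^sup>2 = K\<phi> + 1\<close> and
  \<open>\<phi>\<^bsup>n+1\<^esup> = F\<^bsub>n+1\<^esub> \<phi> + F\<^bsub>n\<^esub>\<close>. Because \<open>\<phi>\<close> is irrational, \<open>N\<close> is a period modulo \<open>p\<close> as soon as
  \<open>\<phi>\<^sup>N \<equiv> 1\<close> modulo \<open>p\<close> in the ring \<open>\<int>[\<phi>]\<close>. The Frobenius map gives
  \<open>2\<phi>\<^sup>p - K \<equiv> (2\<phi> - K)\<^sup>p = D\<^bsup>(p-1)/2\<^esup> (2\<phi> - K)\<close>, and by Euler's criterion \<open>D\<^bsup>(p-1)/2\<^esup>\<close> is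
  \<open>1\<close>, \<open>-1\<close> or \<open>0\<close> modulo \<open>p\<close>. Accordingly \<open>\<phi>\<^bsup>p-1\<^esup> \<equiv> 1\<close>, \<open>\<phi>\<^bsup>p+1\<^esup> \<equiv> -1\<close>, or
  \<open>\<phi>\<^bsup>2p\<^esup> \<equiv> -1\<close>, so the least period divides \<open>p - 1\<close>, \<open>2(p + 1)\<close>, or (only if \<open>p\<close> divides \<open>D\<close>) \<open>4p\<close>.\<close>

section \<open>Congruence modulo an integer in a subring\<close>

text \<open>The ring is a subset of a larger type so that \<int>[\<phi>] can be taken inside the
  reals, where every real would otherwise be a multiple of a nonzero \<open>m\<close>.\<close>

locale subring_cong =
  fixes R :: "'a::comm_ring_1 set" and m :: nat
  assumes one_mem: "1 \<in> R"
    and diff_mem: "\<And>x y. x \<in> R \<Longrightarrow> y \<in> R \<Longrightarrow> x - y \<in> R"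
    and mult_mem: "\<And>x y. x \<in> R \<Longrightarrow> y \<in> R \<Longrightarrow> x * y \<in> R"
begin

definition eqv :: "'a \<Rightarrow> 'a \<Rightarrow> bool" (infix "\<approx>" 50) where
  "x \<approx> y \<longleftrightarrow> (\<exists>z\<in>R. x - y = of_nat m * z)"

lemma zero_mem: "0 \<in> R"
  using diff_mem[OF one_mem one_mem] by simp

lemma uminus_mem: "x \<in> R \<Longrightarrow> - x \<in> R"
  using diff_mem[OF zero_mem] by simp

lemma add_mem: "x \<in> R \<Longrightarrow> y \<in> R \<Longrightarrow> x + y \<in> R"
  using diff_mem[of x "- y"] uminus_mem by simp

lemma of_nat_mem: "of_nat n \<in> R"
  by (induction n) (auto intro: zero_mem one_mem add_mem)

lemma of_int_mem: "of_int k \<in> R"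
  by (cases k) (auto simp: of_nat_mem intro!: uminus_mem simp del: of_nat_Suc)

lemma power_mem: "x \<in> R \<Longrightarrow> x ^ n \<in> R"
  by (induction n) (auto intro: one_mem mult_mem)

lemma sum_mem: "(\<And>i. i \<in> A \<Longrightarrow> f i \<in> R) \<Longrightarrow> sum f A \<in> R"
  by (induction A rule: infinite_finite_induct) (auto intro: zero_mem add_mem)

lemmas mem_intros = zero_mem one_mem diff_mem mult_mem uminus_mem add_mem of_nat_mem
  of_int_mem power_mem

lemma eqv_refl: "x \<approx> x"
  unfolding eqv_def using zero_mem by (intro bexI[of _ 0]) auto

lemma eqv_sym: "x \<approx> y \<Longrightarrow> y \<approx> x"
  unfolding eqv_def by (metis uminus_mem minus_diff_eq mult_minus_right)

lemma eqv_add: "x \<approx> y \<Longrightarrow> x' \<approx> y' \<Longrightarrow> x + x' \<approx> y + y'"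
  unfolding eqv_def by (metis add_mem add_diff_add distrib_left)

lemma eqv_trans [trans]: "x \<approx> y \<Longrightarrow> y \<approx> z \<Longrightarrow> x \<approx> z"
  using eqv_add[of x y y z] by (simp add: eqv_def)

lemma eqv_mult_left: "c \<in> R \<Longrightarrow> x \<approx> y \<Longrightarrow> c * x \<approx> c * y"
  unfolding eqv_def by (metis mult_mem mult.left_commute right_diff_distrib)

text \<open>The chain passes through \<open>x * y'\<close>: the factors held fixed are first
  \<open>x\<close>, then \<open>y'\<close>, which is why these two lie in \<open>R\<close>.\<close>

lemma eqv_mult:
  assumes "x \<approx> y" "x' \<approx> y'" "x \<in> R" "y' \<in> R"
  shows "x * x' \<approx> y * y'"
  using eqv_trans[OF eqv_mult_left[OF assms(3,2)]] eqv_mult_left[OF assms(4,1)]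
  by (simp add: mult.commute)

lemma eqv_power: "x \<approx> y \<Longrightarrow> x \<in> R \<Longrightarrow> y \<in> R \<Longrightarrow> x ^ n \<approx> y ^ n"
  by (induction n) (auto intro: eqv_refl eqv_mult power_mem)

lemma eqv_of_int: "[a = b] (mod int m) \<Longrightarrow> of_int a \<approx> of_int b"
  unfolding eqv_def cong_iff_dvd_diff
  by (metis dvdE of_int_mem of_int_diff of_int_mult of_int_of_nat_eq)

text \<open>For \<open>m = 2 * h + 1\<close>, the element \<open>- h\<close> inverts 2 modulo
  \<open>m\<close>, so \<open>x - y\<close> is a multiple of \<open>m\<close> up to \<open>h\<close>
  times the given difference.\<close>

lemma eqv_cancel_two:
  assumes "2 * x \<approx> 2 * y" "x \<in> R" "y \<in> R" "odd m"
  shows "x \<approx> y"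
proof -
  obtain h where h: "m = 2 * h + 1" using \<open>odd m\<close> by (rule oddE)
  obtain z where z: "z \<in> R" "2 * x - 2 * y = of_nat m * z"
    using assms(1) by (auto simp: eqv_def)
  have "x - y = of_nat m * (x - y) - of_nat h * (2 * x - 2 * y)"
    by (simp add: h algebra_simps)
  also have "\<dots> = of_nat m * ((x - y) - of_nat h * z)"
    unfolding z(2) by (simp add: algebra_simps)
  finally show ?thesis
    unfolding eqv_def using assms z
    by (intro bexI[of _ "(x - y) - of_nat h * z"]) (auto intro!: mem_intros)
qed

text \<open>A prime \<open>m\<close> divides every binomial coefficient strictly inside its row;
  dividing these by \<open>m\<close> gives the witness in \<open>R\<close>.\<close>

lemma frobenius_add:
  assumes "prime m" "x \<in> R" "y \<in> R"
  shows "(x + y) ^ m \<approx> x ^ m + y ^ m"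
proof -
  let ?t = "\<lambda>k. of_nat (m choose k) * x ^ k * y ^ (m - k)"
  let ?u = "\<lambda>k. of_nat ((m choose k) div m) * x ^ k * y ^ (m - k)"
  have m: "m > 1" using assms(1) by (rule prime_gt_1_nat)
  have "{..m} = insert 0 (insert m {0<..<m})" using m by auto
  then have "(x + y) ^ m = x ^ m + y ^ m + (\<Sum>k\<in>{0<..<m}. ?t k)"
    using m by (simp add: binomial_ring)
  moreover have "(\<Sum>k\<in>{0<..<m}. ?t k) = of_nat m * (\<Sum>k\<in>{0<..<m}. ?u k)"
    unfolding sum_distrib_left
  proof (rule sum.cong)
    fix k assume "k \<in> {0<..<m}"
    then have "m dvd (m choose k)"
      using assms(1) by (intro dvd_choose_prime) auto
    then have "(of_nat (m choose k) :: 'a) = of_nat m * of_nat ((m choose k) div m)"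
      by (metis dvd_mult_div_cancel of_nat_mult)
    then show "?t k = of_nat m * ?u k" by (simp add: mult.assoc)
  qed simp
  ultimately show ?thesis
    unfolding eqv_def using assms
    by (intro bexI[of _ "\<Sum>k\<in>{0<..<m}. ?u k"] sum_mem) (auto intro!: mem_intros)
qed

end

section \<open>The ring \<int>[\<phi>]\<close>

definition int_adjoin :: "real \<Rightarrow> real set" where
  "int_adjoin x = {of_int a + of_int b * x | a b. True}"

text \<open>The quadratic relation reduces the \<open>x\<^sup>2\<close> term of a product to a
  linear one, which gives closure under multiplication.\<close>

lemma subring_cong_int_adjoin:
  assumes "x\<^sup>2 = of_int c * x + of_int d"
  shows "subring_cong (int_adjoin x)"
proof
  show "1 \<in> int_adjoin x"
    unfolding int_adjoin_def by (rule CollectI, rule exI[of _ 1], rule exI[of _ 0]) simp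
  fix u v assume "u \<in> int_adjoin x" "v \<in> int_adjoin x"
  then obtain a b a' b' where u: "u = of_int a + of_int b * x"
    and v: "v = of_int a' + of_int b' * x"
    by (auto simp: int_adjoin_def)
  have "u - v = of_int (a - a') + of_int (b - b') * x"
    by (simp add: u v algebra_simps)
  then show "u - v \<in> int_adjoin x" unfolding int_adjoin_def by blast
  have "u * v = of_int a * of_int a' + (of_int a * of_int b' + of_int b * of_int a') * x
      + of_int b * of_int b' * x\<^sup>2"
    by (simp add: u v algebra_simps power2_eq_square)
  also have "\<dots> = of_int (a * a' + b * b' * d) + of_int (a * b' + b * a' + b * b' * c) * x"
    by (simp add: assms algebra_simps)
  finally show "u * v \<in> int_adjoin x" unfolding int_adjoin_def by blast
qed

text \<open>The number lies strictly between the squares of \<open>K\<close> and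
  \<open>K + 2\<close>, and equality with the square of \<open>K + 1\<close> would mean
  \<open>2 * K = 3\<close>.\<close>

lemma square_plus_four_not_square:
  fixes K c :: int
  assumes "K \<ge> 1"
  shows "K\<^sup>2 + 4 \<noteq> c\<^sup>2"
proof
  assume "K\<^sup>2 + 4 = c\<^sup>2"
  then have eq: "K\<^sup>2 + 4 = \<bar>c\<bar>\<^sup>2" by simp
  have "K < \<bar>c\<bar>" using eq by (intro power2_less_imp_less[of K]) auto
  moreover have "\<bar>c\<bar> < K + 2"
    using eq assms by (intro power2_less_imp_less[of "\<bar>c\<bar>"]) (auto simp: power2_eq_square algebra_simps)
  ultimately have "\<bar>c\<bar> = K + 1" by simp
  then have "2 * K = 3" using eq by (simp add: power2_eq_square algebra_simps)
  then show False by presburger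
qed

definition kphi :: "nat \<Rightarrow> real" where
  "kphi K = (of_nat K + sqrt (of_nat (K\<^sup>2 + 4))) / 2"

lemma kphi_discriminant: "(2 * kphi K - of_nat K)\<^sup>2 = of_nat (K\<^sup>2 + 4)"
proof -
  have "2 * kphi K - of_nat K = sqrt (of_nat (K\<^sup>2 + 4))"
    unfolding kphi_def by (simp add: field_simps)
  then show ?thesis by simp
qed

lemma kphi_square: "(kphi K)\<^sup>2 = of_nat K * kphi K + 1"
  using kphi_discriminant[of K] by (simp add: power2_eq_square algebra_simps)

text \<open>Starting at exponent 1 avoids a Fibonacci number of index -1 as a coefficient.\<close>

lemma kphi_power: "kphi K ^ Suc n = of_nat (kfib K (Suc n)) * kphi K + of_nat (kfib K n)"
proof (induction n)
  case (Suc n)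
  have "kphi K ^ Suc (Suc n) = kphi K * kphi K ^ Suc n" by simp
  also have "\<dots> = of_nat (kfib K (Suc n)) * (kphi K)\<^sup>2 + of_nat (kfib K n) * kphi K"
    unfolding Suc.IH by (simp add: power2_eq_square algebra_simps)
  also have "\<dots> = of_nat (kfib K (Suc (Suc n))) * kphi K + of_nat (kfib K (Suc n))"
    by (simp add: kphi_square algebra_simps)
  finally show ?case .
qed simp

text \<open>A relation with \<open>b \<noteq> 0\<close> makes
  \<open>b\<^sup>2 * (K\<^sup>2 + 4)\<close> a perfect square, hence also
  \<open>K\<^sup>2 + 4\<close>, which is impossible.\<close>

lemma kphi_independent:
  fixes a b :: int
  assumes "K \<ge> 1" "of_int a + of_int b * kphi K = 0"
  shows "a = 0 \<and> b = 0"
proof (cases "b = 0")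
  case False
  have "of_int b * (2 * kphi K - of_nat K) = (of_int (- (2 * a + int K * b)) :: real)"
    using assms(2) by (simp add: algebra_simps)
  then have "(of_int b)\<^sup>2 * of_nat (K\<^sup>2 + 4) = ((of_int (- (2 * a + int K * b)))\<^sup>2 :: real)"
    by (metis kphi_discriminant power_mult_distrib)
  then have "real_of_int (b\<^sup>2 * (int K ^ 2 + 4)) = real_of_int ((- (2 * a + int K * b))\<^sup>2)"
    by simp
  then have eq: "b\<^sup>2 * ((int K)\<^sup>2 + 4) = (- (2 * a + int K * b))\<^sup>2"
    by (simp only: of_int_eq_iff)
  then have "b\<^sup>2 dvd (- (2 * a + int K * b))\<^sup>2" by (metis dvd_triv_left)
  then have "b dvd - (2 * a + int K * b)" by (simp only: pow_divides_pow_iff zero_less_numeral)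
  then obtain c where "- (2 * a + int K * b) = b * c" by (rule dvdE)
  then have "(int K)\<^sup>2 + 4 = c\<^sup>2"
    using eq False by (simp add: power_mult_distrib)
  then show ?thesis
    using square_plus_four_not_square[of "int K" c] assms(1) by simp
qed (use assms in simp)

interpretation kphi: subring_cong "int_adjoin (kphi K)" m for K m
  by (rule subring_cong_int_adjoin[where c = "int K" and d = 1]) (simp add: kphi_square)

lemma kphi_mem: "kphi K \<in> int_adjoin (kphi K)"
  unfolding int_adjoin_def by (rule CollectI, rule exI[of _ 0], rule exI[of _ 1]) simp

section \<open>Periods from powers of \<phi>\<close>

lemma is_kfib_period_if_kphi_power:
  assumes "K \<ge> 1" "N > 0" "kphi.eqv K m (kphi K ^ N) 1"
  shows "is_kfib_period K m N"
proof -
  have "[kfib K (n + N) = kfib K n] (mod m)" for n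
  proof -
    have "kphi.eqv K m (kphi K ^ Suc n * kphi K ^ N) (kphi K ^ Suc n * 1)"
      by (intro kphi.eqv_mult_left kphi.power_mem kphi_mem assms)
    then have "kphi.eqv K m (kphi K ^ Suc (n + N)) (kphi K ^ Suc n)"
      by (simp add: power_add mult.assoc)
    then obtain a b where "kphi K ^ Suc (n + N) - kphi K ^ Suc n
        = of_nat m * (of_int a + of_int b * kphi K)"
      unfolding kphi.eqv_def by (auto simp: int_adjoin_def)
    then have "of_int (int (kfib K (n + N)) - int (kfib K n) - int m * a)
      + of_int (int (kfib K (Suc (n + N))) - int (kfib K (Suc n)) - int m * b) * kphi K = 0"
      unfolding kphi_power by (simp add: algebra_simps)
    \<comment> \<open>The exponent \<open>Suc n\<close> was chosen because the constant coefficient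
      of that power is \<open>kfib K n\<close>.\<close>
    from kphi_independent[OF assms(1) this]
    have "int (kfib K (n + N)) - int (kfib K n) = int m * a" by simp
    then show ?thesis
      by (metis cong_iff_dvd_diff cong_int_iff dvd_triv_left)
  qed
  then show ?thesis using assms(2) by (simp add: is_kfib_period_def)
qed

text \<open>Were the remainder of \<open>N\<close> modulo the least period nonzero, it would be a
  smaller period.\<close>

lemma kpisano_dvd_period:
  assumes "is_kfib_period K m N"
  shows "kpisano K m dvd N"
proof -
  let ?t = "kpisano K m"
  have t: "is_kfib_period K m ?t"
    unfolding kpisano_def using assms by (rule LeastI)
  have mult: "[kfib K (n + j * ?t) = kfib K n] (mod m)" for n j
  proof (induction j)
    case (Suc j)
    have "[kfib K (n + j * ?t + ?t) = kfib K (n + j * ?t)] (mod m)"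
      using t by (simp add: is_kfib_period_def)
    then show ?case using Suc by (simp add: add_ac) (metis cong_trans)
  qed simp
  have "[kfib K (n + N mod ?t) = kfib K n] (mod m)" for n
  proof -
    have "[kfib K (n + N mod ?t + N div ?t * ?t) = kfib K (n + N mod ?t)] (mod m)"
      by (rule mult)
    moreover have "n + N mod ?t + N div ?t * ?t = n + N"
      by (simp only: add.assoc mod_div_mult_eq)
    ultimately show ?thesis
      using assms unfolding is_kfib_period_def by (metis cong_sym cong_trans)
  qed
  moreover have "N mod ?t < ?t" using t by (simp add: is_kfib_period_def)
  ultimately have "N mod ?t = 0"
    using not_less_Least[of "N mod ?t" "is_kfib_period K m"]
    by (auto simp: kpisano_def is_kfib_period_def)
  then show ?thesis by (simp add: mod_eq_0_iff_dvd)
qed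

section \<open>The Frobenius map and the three cases\<close>

lemma kphi_frobenius:
  assumes "prime p" "odd p"
  shows "kphi.eqv K p (2 * kphi K ^ p)
    (of_nat K + of_int (int (K\<^sup>2 + 4) ^ ((p - 1) div 2)) * (2 * kphi K - of_nat K))"
proof -
  let ?f = "kphi K" and ?s = "2 * kphi K - of_nat K"
  let ?u = "of_int (int (K\<^sup>2 + 4) ^ ((p - 1) div 2)) :: real"
  \<comment> \<open>Multiples of \<open>p\<close> are included because \<open>K\<close> may be
    one.\<close>
  have fermat: "[int a ^ p = int a] (mod int p)" for a
  proof (cases "p dvd a")
    case True
    then have "[int a = 0] (mod int p)" by (simp add: cong_0_iff)
    with cong_pow[OF this, of p] show ?thesis
      using prime_gt_0_nat[OF assms(1)] by (metis cong_sym cong_trans zero_power)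
  next
    case False
    have "[a * a ^ (p - 1) = a * 1] (mod p)"
      by (intro cong_scalar_left fermat_theorem assms False)
    moreover have "a * a ^ (p - 1) = a ^ p"
      using prime_gt_0_nat[OF assms(1)] by (simp add: power_eq_if)
    ultimately show ?thesis by (metis cong_int_iff mult_1_right of_nat_power)
  qed
  have two: "(2::real) \<in> int_adjoin ?f" using kphi.of_nat_mem[of 2] by simp
  have s: "?s \<in> int_adjoin ?f"
    by (intro kphi.mem_intros kphi_mem two)
  have "p = Suc (2 * ((p - 1) div 2))" using assms by presburger
  then have "?s ^ p = (?s\<^sup>2) ^ ((p - 1) div 2) * ?s"
    by (metis power_Suc2 power_mult)
  then have sp: "?s ^ p = ?u * ?s"
    by (simp only: kphi_discriminant of_int_power of_int_of_nat_eq)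
  have "kphi.eqv K p (2 * ?f ^ p) (2 ^ p * ?f ^ p)"
  proof (rule kphi.eqv_mult)
    show "kphi.eqv K p 2 (2 ^ p)"
      using kphi.eqv_sym[OF kphi.eqv_of_int[OF fermat[of 2]]] by simp
  qed (auto intro!: kphi.eqv_refl kphi.mem_intros kphi_mem two)
  also have "2 ^ p * ?f ^ p = (of_nat K + ?s) ^ p"
    by (simp add: power_mult_distrib)
  also have "kphi.eqv K p \<dots> (of_nat K ^ p + ?s ^ p)"
    by (intro kphi.frobenius_add assms s kphi.mem_intros)
  also have "kphi.eqv K p \<dots> (of_nat K + ?s ^ p)"
    using kphi.eqv_of_int[OF fermat[of K]] by (intro kphi.eqv_add kphi.eqv_refl) simp
  finally show ?thesis by (simp only: sp)
qed

lemma kpisano_dvd_cases: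
  assumes "K \<ge> 1" "prime p" "odd p"
  shows "kpisano K p dvd p - 1 \<or> kpisano K p dvd 2 * (p + 1) \<or>
    p dvd K\<^sup>2 + 4 \<and> kpisano K p dvd 4 * p"
proof -
  let ?f = "kphi K" and ?D = "int (K\<^sup>2 + 4)"
  let ?s = "2 * kphi K - of_nat K"
  let ?u = "?D ^ ((p - 1) div 2)"
  note mems = kphi.mem_intros kphi_mem
  have p: "p > 2" using assms prime_ge_2_nat[of p] by (cases "p = 2") auto
  have two: "(2::real) \<in> int_adjoin ?f" using kphi.of_nat_mem[of 2] by simp
  have s: "?s \<in> int_adjoin ?f" by (intro mems two)
  \<comment> \<open>So \<phi> is a unit: multiplying by \<open>?f - of_nat K\<close> lowers an
    exponent by one.\<close>
  have inv: "?f * (?f - of_nat K) = 1"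
    using kphi_square[of K] by (simp add: power2_eq_square algebra_simps)
  have frob: "kphi.eqv K p (2 * ?f ^ p) (of_nat K + of_int c * ?s)"
    if "[?u = c] (mod int p)" for c
  proof -
    have "kphi.eqv K p (of_nat K + of_int ?u * ?s) (of_nat K + of_int c * ?s)"
      by (intro kphi.eqv_add kphi.eqv_refl kphi.eqv_mult kphi.eqv_of_int that s kphi.mem_intros)
    with kphi_frobenius[OF assms(2,3)] show ?thesis by (rule kphi.eqv_trans)
  qed
  have double: "kpisano K p dvd 2 * N" if "N > 0" "kphi.eqv K p (?f ^ N) (- 1)" for N
  proof -
    have "kphi.eqv K p ((?f ^ N)\<^sup>2) ((- 1)\<^sup>2)"
      by (intro kphi.eqv_power that mems)
    then have "kphi.eqv K p (?f ^ (2 * N)) 1"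
      by (simp add: power_mult[symmetric] mult.commute)
    then show ?thesis
      using that assms by (intro kpisano_dvd_period is_kfib_period_if_kphi_power) auto
  qed
  have euler: "[?u = Legendre ?D (int p)] (mod int p)"
    using euler_criterion[of p ?D] assms(2) p by (simp add: cong_sym)
  consider "Legendre ?D (int p) = 1" | "Legendre ?D (int p) = -1"
    | "Legendre ?D (int p) = 0" "p dvd K\<^sup>2 + 4"
    unfolding Legendre_def cong_0_iff int_dvd_int_iff by metis
  then show ?thesis
  proof cases
    case 1
    have "kphi.eqv K p (2 * ?f ^ p) (2 * ?f)"
      using frob[of 1] euler 1 by simp
    then have "kphi.eqv K p (?f ^ p) ?f"
      by (rule kphi.eqv_cancel_two) (auto intro!: mems assms)
    then have "kphi.eqv K p ((?f - of_nat K) * ?f ^ p) ((?f - of_nat K) * ?f)"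
      by (intro kphi.eqv_mult_left mems)
    moreover have "(?f - of_nat K) * ?f ^ p = ?f * (?f - of_nat K) * ?f ^ (p - 1)"
      using p by (simp add: power_eq_if)
    ultimately have "kphi.eqv K p (?f ^ (p - 1)) 1"
      using inv by (simp add: mult.commute)
    then show ?thesis
      using p assms by (intro disjI1 kpisano_dvd_period is_kfib_period_if_kphi_power) auto
  next
    case 2
    have "kphi.eqv K p (2 * ?f ^ p) (2 * (of_nat K - ?f))"
      using frob[of "-1"] euler 2 by (simp add: algebra_simps)
    then have "kphi.eqv K p (?f ^ p) (of_nat K - ?f)"
      by (rule kphi.eqv_cancel_two) (auto intro!: mems assms)
    then have "kphi.eqv K p (?f * ?f ^ p) (?f * (of_nat K - ?f))"
      by (intro kphi.eqv_mult_left mems)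
    \<comment> \<open>\<open>of_nat K - ?f\<close> is the conjugate of \<phi>, and \<phi> has norm
      -1.\<close>
    moreover have "?f * (of_nat K - ?f) = - 1"
      using inv by (simp add: algebra_simps)
    ultimately have "kphi.eqv K p (?f ^ (p + 1)) (- 1)" by simp
    then show ?thesis using double[of "p + 1"] by simp
  next
    case 3
    have "kphi.eqv K p (2 * ?f ^ p) (of_nat K)"
      using frob[of 0] euler 3 by simp
    \<comment> \<open>Squaring replaces \<open>K\<close> by \<open>K\<^sup>2\<close>, which is -4
      modulo \<open>p\<close>; the factor 4 is then removed by cancelling 2 twice.\<close>
    then have "kphi.eqv K p ((2 * ?f ^ p)\<^sup>2) ((of_nat K)\<^sup>2)"
      by (intro kphi.eqv_power mems two)
    also have "kphi.eqv K p ((of_nat K)\<^sup>2) (of_int (- 4))"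
    proof -
      have "int p dvd ?D" using 3 by (simp only: int_dvd_int_iff)
      then have "[(int K)\<^sup>2 = - 4] (mod int p)" by (simp add: cong_iff_dvd_diff)
      from kphi.eqv_of_int[OF this] show ?thesis by simp
    qed
    finally have "kphi.eqv K p (2 * (2 * ?f ^ (2 * p))) (2 * (2 * (- 1)))"
      by (simp add: power_mult_distrib power_mult[symmetric] mult.commute)
    then have "kphi.eqv K p (2 * ?f ^ (2 * p)) (2 * (- 1))"
      by (rule kphi.eqv_cancel_two) (intro mems two assms)+
    then have "kphi.eqv K p (?f ^ (2 * p)) (- 1)"
      by (rule kphi.eqv_cancel_two) (intro mems assms)+
    then show ?thesis using double[of "2 * p"] p 3 by simp
  qed
qed

section \<open>Prime divisors of the period\<close>

theorem theorem2p11: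
  fixes K p q :: nat
  assumes "K \<ge> 1"
    and "prime p" and "odd p"
    and "prime q" and "q dvd kpisano K p"
  shows "q \<le> p \<and> (q = p \<longrightarrow> p dvd K\<^sup>2 + 4)"
proof -
  have p: "p > 2" using assms prime_ge_2_nat[of p] by (cases "p = 2") auto
  consider "q dvd p - 1" | "q dvd 2 * (p + 1)" | "p dvd K\<^sup>2 + 4" "q dvd 4 * p"
    using kpisano_dvd_cases[OF assms(1-3)] assms(5) dvd_trans by blast
  then show ?thesis
  proof cases
    case 1
    then have "q \<le> p - 1" using p by (intro dvd_imp_le) auto
    then show ?thesis using p by auto
  next
    case 2
    then have "q dvd 2 \<or> q dvd p + 1" using assms(4) by (simp only: prime_dvd_mult_iff)
    moreover have "q < p" if "q dvd 2" using dvd_imp_le[OF that] p by simp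
    moreover have "q < p" if "q dvd p + 1"
    proof -
      have "q \<le> p + 1" using that by (rule dvd_imp_le) simp
      \<comment> \<open>\<open>p + 1\<close> is even and exceeds 2, so it is not prime.\<close>
      moreover have "q \<noteq> p + 1"
        using assms(3,4) p primes_dvd_imp_eq[of 2 q] by auto
      \<comment> \<open>Otherwise \<open>p\<close> would divide 1.\<close>
      moreover have "q \<noteq> p"
        using that p dvd_add_right_iff[of p p 1] by auto
      ultimately show ?thesis by simp
    qed
    ultimately show ?thesis by auto
  next
    case 3
    have "q dvd 2 * 2 * p" using 3 by simp
    then have "q dvd 2 \<or> q dvd p" using assms(4) by (auto simp only: prime_dvd_mult_iff)
    then have "q \<le> p" using p by (auto dest: dvd_imp_le)
    then show ?thesis using 3 by simp
  qed
qed

end
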